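(* Let $H$ be a separable Hilbert space, let $A\colon H\to H$ be a (bounded) normal operator, and let $x\in H$ be such that $A^nx\ne 0$ for all $n\ge 0$. Assume that at least one of the following conditions holds. (a) There exists an infinite-dimensional closed subspace $M$ of $H$ such that $\{P_MA^nx\}_{n\ge 0}$ is a frame for $M$. (b) $\|A\|\le 1$ and there exists an infinite-dimensional closed subspace $M$ of $H$ such that $\{P_MA^nx\}_{n\ge 0}$ satisfies a lower frame condition in $M$. (c) There exists a finite subset $J$ of $\mathbb{N}$ such that $\{A^nx\}_{n\ge 0,\,n\notin J}$ is a frame for its closed span. Then $\left\{\frac{A^nx}{\|A^nx\|}\right\}_{n\ge 0}$ is not a frame for $H$.
   Context: All families are regarded as countable indexed families (repetitions counted). A countable family $\{z_j\}$ in a separable Hilbert space $K$ is a frame for $K$ if there are constants $0<L\le L'$ with $L\|y\|^2\le\sum_j|\langle y,z_j\rangle|^2\le L'\|y\|^2$ for all $y\in K$; it satisfies a lower frame condition in $K$ if the left inequality holds for some $L>0$. $P_M$ is the orthogonal projection of $H$ onto $M$. *)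

theory Defs
  imports "HOL-Analysis.Analysis"
begin

text \<open>Complex Hilbert spaces as a type class over the real normed spaces of the library, so that
  the norm, topology and operator norm are the library's. The inner product is linear in the first
  argument and conjugate-linear in the second.\<close>

class complex_inner = real_normed_vector +
  fixes scaleC :: "complex \<Rightarrow> 'a \<Rightarrow> 'a" (infixr "*\<^sub>C" 75)
    and cinner :: "'a \<Rightarrow> 'a \<Rightarrow> complex"
  assumes scaleC_add_right: "c *\<^sub>C (x + y) = c *\<^sub>C x + c *\<^sub>C y"
    and scaleC_add_left: "(c + d) *\<^sub>C x = c *\<^sub>C x + d *\<^sub>C x"
    and scaleC_scaleC: "c *\<^sub>C d *\<^sub>C x = (c * d) *\<^sub>C x"
    and scaleR_scaleC: "r *\<^sub>R x = complex_of_real r *\<^sub>C x"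
    and cinner_add_left: "cinner (x + y) z = cinner x z + cinner y z"
    and cinner_scaleC_left: "cinner (c *\<^sub>C x) y = c * cinner x y"
    and cinner_commute: "cinner x y = cnj (cinner y x)"
    and cinner_self: "cinner x x = complex_of_real ((norm x)\<^sup>2)"

class chilbert_space = complex_inner + complete_space

lemma scaleC_one: "1 *\<^sub>C x = (x :: 'a :: complex_inner)"
  using scaleR_scaleC[of 1 x] by simp

global_interpretation complex_vector:
  vector_space "scaleC :: complex \<Rightarrow> 'a \<Rightarrow> 'a :: complex_inner"
  defines csubspace = complex_vector.subspace
    and cspan = complex_vector.span
  by unfold_locales
    (simp_all add: scaleC_add_right scaleC_add_left scaleC_scaleC scaleC_one)

definition closed_csubspace :: "'a :: complex_inner set \<Rightarrow> bool" where
  "closed_csubspace M \<longleftrightarrow> csubspace M \<and> closed M"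

definition cfinite_dim :: "'a :: complex_inner set \<Rightarrow> bool" where
  "cfinite_dim M \<longleftrightarrow> (\<exists>B. finite B \<and> B \<subseteq> M \<and> cspan B = M)"

definition bounded_clinear :: "('a :: complex_inner \<Rightarrow> 'b :: complex_inner) \<Rightarrow> bool" where
  "bounded_clinear A \<longleftrightarrow> bounded_linear A \<and> (\<forall>c x. A (c *\<^sub>C x) = c *\<^sub>C A x)"

text \<open>For a bounded operator on a Hilbert space the map described here exists by the Riesz
  representation theorem and is unique.\<close>

definition cadjoint :: "('a :: complex_inner \<Rightarrow> 'b :: complex_inner) \<Rightarrow> 'b \<Rightarrow> 'a" where
  "cadjoint A = (THE B. \<forall>x y. cinner (A x) y = cinner x (B y))"

definition normal_operator :: "('a :: chilbert_space \<Rightarrow> 'a) \<Rightarrow> bool" where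
  "normal_operator A \<longleftrightarrow> bounded_clinear A \<and> A \<circ> cadjoint A = cadjoint A \<circ> A"

text \<open>Well defined when \<open>M\<close> is a closed subspace of a Hilbert space.\<close>

definition oproj :: "'a :: complex_inner set \<Rightarrow> 'a \<Rightarrow> 'a" where
  "oproj M x = (THE y. y \<in> M \<and> (\<forall>z\<in>M. cinner (x - y) z = 0))"

text \<open>The sum \<open>\<Sum>\<^sub>j |\<langle>y, z\<^sub>j\<rangle>|\<^sup>2\<close> is taken in the extended nonnegative reals, where it always exists
  (possibly with value \<open>\<infinity>\<close>), so no summability is presupposed in a lower frame condition.\<close>

definition frame_sum :: "'i set \<Rightarrow> ('i \<Rightarrow> 'a :: complex_inner) \<Rightarrow> 'a \<Rightarrow> ennreal" where
  "frame_sum I z y = (\<Sum>\<^sub>\<infinity>j\<in>I. ennreal ((cmod (cinner y (z j)))\<^sup>2))"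

text \<open>In both definitions \<open>K\<close> is meant to be a closed subspace, regarded as a Hilbert space in its
  own right; the family is a map on the index set \<open>I\<close>, so repetitions count.\<close>

definition lower_frame_condition ::
    "'i set \<Rightarrow> ('i \<Rightarrow> 'a :: complex_inner) \<Rightarrow> 'a set \<Rightarrow> bool" where
  "lower_frame_condition I z K \<longleftrightarrow>
     countable I \<and> (\<forall>j\<in>I. z j \<in> K) \<and>
     (\<exists>L::real. 0 < L \<and> (\<forall>y\<in>K. ennreal (L * (norm y)\<^sup>2) \<le> frame_sum I z y))"

definition is_frame :: "'i set \<Rightarrow> ('i \<Rightarrow> 'a :: complex_inner) \<Rightarrow> 'a set \<Rightarrow> bool" where
  "is_frame I z K \<longleftrightarrow>
     countable I \<and> (\<forall>j\<in>I. z j \<in> K) \<and>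
     (\<exists>L L'::real. 0 < L \<and> L \<le> L' \<and>
        (\<forall>y\<in>K. ennreal (L * (norm y)\<^sup>2) \<le> frame_sum I z y \<and>
                frame_sum I z y \<le> ennreal (L' * (norm y)\<^sup>2)))"

end

theory Submission
  imports Defs
begin

text \<open>By normality \<open>\<parallel>A\<^sup>n x\<parallel>\<close> is log-convex in \<open>n\<close>, so it tends to \<open>0\<close>, tends to \<open>\<infinity>\<close>, or stays between two
  positive constants. Suppose the normalized orbit is a frame. In the bounded case the orbit itself is
  a frame for \<open>H\<close>; applying its lower bound to \<open>A\<^sup>*\<^sup>k x\<close> bounds \<open>\<parallel>A\<^sup>*\<^sup>k x\<parallel> = \<parallel>A\<^sup>k x\<parallel>\<close> by the tail of a
  convergent series, so it tends to \<open>0\<close>, a contradiction. In the other two cases one of the two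
  families (orbit, normalized orbit) is a null multiple of the other. Testing on a vector of \<open>M\<close>
  orthogonal to the first \<open>N\<close> members, which exists because \<open>M\<close> is infinite-dimensional, contradicts
  the lower bound of the former and the Bessel bound of the latter. Condition (c) reduces to (a)
  with \<open>M\<close> the closed span; if that span is finite-dimensional, so is the span of the whole orbit, and
  a Bessel family there tends to \<open>0\<close> in norm, hence does not consist of unit vectors.\<close>

section \<open>Algebra of the inner product, Pythagoras and Cauchy-Schwarz\<close>

lemma cinner_add_right: "cinner x (y + z) = cinner x y + cinner x (z :: 'a :: complex_inner)"
  by (metis cinner_add_left cinner_commute complex_cnj_add)

lemma cinner_scaleC_right: "cinner x (c *\<^sub>C y) = cnj c * cinner x (y :: 'a :: complex_inner)"
  by (metis cinner_scaleC_left cinner_commute complex_cnj_mult)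

lemma cinner_zero_left [simp]: "cinner 0 (x :: 'a :: complex_inner) = 0"
  using cinner_add_left[of 0 0 x] by simp

lemma cinner_zero_right [simp]: "cinner (x :: 'a :: complex_inner) 0 = 0"
  using cinner_add_right[of x 0 0] by simp

lemma cinner_diff_left: "cinner (x - y) z = cinner x z - cinner y (z :: 'a :: complex_inner)"
  using cinner_add_left[of "x - y" y z] by simp

lemma cinner_diff_right: "cinner x (y - z) = cinner x y - cinner x (z :: 'a :: complex_inner)"
  using cinner_add_right[of x "y - z" z] by simp

lemma cinner_scaleR_right: "cinner x (r *\<^sub>R y) = of_real r * cinner x (y :: 'a :: complex_inner)"
  by (simp add: scaleR_scaleC cinner_scaleC_right)

lemma cinner_sum_left:
  fixes g :: "'i \<Rightarrow> 'a :: complex_inner"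
  shows "cinner (\<Sum>i\<in>I. g i) y = (\<Sum>i\<in>I. cinner (g i) y)"
  by (induction I rule: infinite_finite_induct) (simp_all add: cinner_add_left)

lemma cmod_cinner_commute: "cmod (cinner x y) = cmod (cinner y (x :: 'a :: complex_inner))"
  by (metis cinner_commute complex_mod_cnj)

lemma cinner_eq_zero_commute: "cinner x y = 0 \<longleftrightarrow> cinner y (x :: 'a :: complex_inner) = 0"
  by (metis cinner_commute complex_cnj_zero)

lemma cinner_self_eq_zero [simp]: "cinner x x = 0 \<longleftrightarrow> (x :: 'a :: complex_inner) = 0"
  by (simp add: cinner_self)

lemma cinner_ext_right:
  fixes x y :: "'a :: complex_inner"
  assumes "\<And>z. cinner z x = cinner z y"
  shows "x = y"
  using assms[of "x - y"] cinner_self_eq_zero[of "x - y"] by (simp add: cinner_diff_right)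

lemma norm_scaleC: "norm (c *\<^sub>C x) = cmod c * norm (x :: 'a :: complex_inner)"
proof -
  have "complex_of_real ((norm (c *\<^sub>C x))\<^sup>2) = c * cnj c * complex_of_real ((norm x)\<^sup>2)"
    by (simp only: cinner_self[symmetric] cinner_scaleC_left cinner_scaleC_right ac_simps)
  also have "\<dots> = complex_of_real ((cmod c * norm x)\<^sup>2)"
    by (simp only: complex_norm_square[symmetric] of_real_mult power_mult_distrib)
  finally have "(norm (c *\<^sub>C x))\<^sup>2 = (cmod c * norm x)\<^sup>2"
    using of_real_eq_iff by blast
  then show ?thesis by (simp add: power2_eq_iff_nonneg)
qed

text \<open>Pythagoras: the subtracted vector is the projection of \<open>u\<close> onto the line
  through \<open>z\<close>, so the remainder is orthogonal to \<open>z\<close>. This yields both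
  Cauchy-Schwarz and the orthogonality of nearest points.\<close>

lemma norm_diff_component_sq:
  fixes u z :: "'a :: complex_inner"
  assumes "z \<noteq> 0"
  shows "(norm (u - (cinner u z / cinner z z) *\<^sub>C z))\<^sup>2
    = (norm u)\<^sup>2 - (cmod (cinner u z))\<^sup>2 / (norm z)\<^sup>2"
proof -
  define t where "t = cinner u z / cinner z z"
  have zz: "cinner z z = complex_of_real ((norm z)\<^sup>2)" by (rule cinner_self)
  have nz: "cinner z z \<noteq> 0" using assms by simp
  have "cinner (u - t *\<^sub>C z) z = 0"
    using nz by (simp add: cinner_diff_left cinner_scaleC_left t_def)
  then have "complex_of_real ((norm (u - t *\<^sub>C z))\<^sup>2) = cinner (u - t *\<^sub>C z) u"
    by (simp only: cinner_self[symmetric] cinner_diff_right[of _ u] cinner_scaleC_right) simp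
  also have "\<dots> = complex_of_real ((norm u)\<^sup>2) - cinner u z * cnj (cinner u z) / cinner z z"
    by (simp add: cinner_diff_left cinner_scaleC_left cinner_self[of u] t_def
        cinner_commute[of z u])
  also have "\<dots> = complex_of_real ((norm u)\<^sup>2 - (cmod (cinner u z))\<^sup>2 / (norm z)\<^sup>2)"
    by (simp only: complex_norm_square[symmetric] zz of_real_diff of_real_divide)
  finally show ?thesis
    unfolding t_def[symmetric] using of_real_eq_iff by blast
qed

lemma cmod_cinner_le: "cmod (cinner u z) \<le> norm u * norm (z :: 'a :: complex_inner)"
proof (cases "z = 0")
  case False
  have "0 \<le> (norm u)\<^sup>2 - (cmod (cinner u z))\<^sup>2 / (norm z)\<^sup>2"
    using norm_diff_component_sq[OF False, of u] by (metis zero_le_power2)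
  then have "(cmod (cinner u z))\<^sup>2 \<le> (norm u * norm z)\<^sup>2"
    using False by (simp add: field_simps)
  then show ?thesis by (rule power2_le_imp_le) simp
qed simp

lemma parallelogram_cinner:
  fixes u v :: "'a :: complex_inner"
  shows "(norm (u + v))\<^sup>2 + (norm (u - v))\<^sup>2 = 2 * (norm u)\<^sup>2 + 2 * (norm v)\<^sup>2"
proof -
  have "complex_of_real ((norm (u + v))\<^sup>2 + (norm (u - v))\<^sup>2)
      = complex_of_real (2 * (norm u)\<^sup>2 + 2 * (norm v)\<^sup>2)"
    by (simp only: of_real_add of_real_mult cinner_self[symmetric] cinner_add_left
        cinner_add_right cinner_diff_left cinner_diff_right) simp
  then show ?thesis using of_real_eq_iff by blast
qed

lemma bounded_linear_cinner_left: "bounded_linear (\<lambda>x. cinner x (y :: 'a :: complex_inner))"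
proof (rule bounded_linear_intro)
  show "norm (cinner x y) \<le> norm x * norm y" for x by (rule cmod_cinner_le)
qed (simp_all add: cinner_add_left scaleR_scaleC cinner_scaleC_left scaleR_conv_of_real)

subsection \<open>Projections, the Riesz representation and the adjoint\<close>

text \<open>A minimizing sequence in \<open>M\<close> is Cauchy by the parallelogram law, because
  midpoints stay in \<open>M\<close> and so are no closer to \<open>x\<close> than the infimum
  \<open>d\<close>.\<close>

lemma nearest_point_exists:
  fixes x :: "'a :: chilbert_space"
  assumes M: "closed_csubspace M"
  shows "\<exists>y\<in>M. \<forall>z\<in>M. norm (x - y) \<le> norm (x - z)"
proof -
  have sub: "csubspace M" and cl: "closed M" using M by (auto simp: closed_csubspace_def)
  have zero: "0 \<in> M" by (rule complex_vector.subspace_0[OF sub])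
  define d where "d = (INF y\<in>M. norm (x - y))"
  have bdd: "bdd_below ((\<lambda>y. norm (x - y)) ` M)" by (rule bdd_belowI2[of _ 0]) simp
  have d_le: "d \<le> norm (x - y)" if "y \<in> M" for y
    unfolding d_def by (rule cINF_lower[OF bdd that])
  have d0: "0 \<le> d" unfolding d_def by (rule cINF_greatest) (use zero in auto)
  have "\<exists>y\<in>M. norm (x - y) < d + 1 / real (Suc n)" for n
  proof -
    have "Inf ((\<lambda>y. norm (x - y)) ` M) < d + 1 / real (Suc n)"
      by (simp add: d_def)
    then show ?thesis using cINF_less_iff[OF _ bdd] zero by blast
  qed
  then obtain f where fM: "\<And>n. f n \<in> M" and f: "\<And>n. norm (x - f n) < d + 1 / real (Suc n)"
    by metis
  \<comment> \<open>Parallelogram law for \<open>x - f m\<close> and \<open>x - f n\<close>: their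
    sum is twice the vector from the midpoint to \<open>x\<close>, hence has norm at least
    \<open>2 * d\<close>.\<close>
  have key: "(norm (f m - f n))\<^sup>2
      \<le> 2 * (d + 1 / real (Suc m))\<^sup>2 + 2 * (d + 1 / real (Suc n))\<^sup>2 - 4 * d\<^sup>2" for m n
  proof -
    have "(1/2) *\<^sub>R (f m + f n) \<in> M"
      using fM sub
      by (simp add: scaleR_scaleC complex_vector.subspace_add complex_vector.subspace_scale)
    then have "d \<le> norm (x - (1/2) *\<^sub>R (f m + f n))" by (rule d_le)
    also have "x - (1/2) *\<^sub>R (f m + f n) = (1/2) *\<^sub>R ((x - f m) + (x - f n))"
    proof -
      have "x = (1/2) *\<^sub>R (x + x)" by (simp add: scaleR_2[symmetric])
      then show ?thesis by (simp add: algebra_simps)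
    qed
    finally have "2 * d \<le> norm ((x - f m) + (x - f n))" by simp
    then have "(2 * d)\<^sup>2 \<le> (norm ((x - f m) + (x - f n)))\<^sup>2"
      by (rule power_mono) (use d0 in simp)
    moreover have "(x - f m) - (x - f n) = f n - f m" by simp
    moreover have "(norm (x - f k))\<^sup>2 \<le> (d + 1 / real (Suc k))\<^sup>2" for k
      by (rule power_mono) (use f[of k] in auto)
    ultimately show ?thesis
      using parallelogram_cinner[of "x - f m" "x - f n"]
      by (simp add: norm_minus_commute power_mult_distrib) (smt (verit))
  qed
  have lim: "(\<lambda>n. d + 1 / real (Suc n)) \<longlonglongrightarrow> d"
    using tendsto_add[OF tendsto_const LIMSEQ_inverse_real_of_nat, of d]
    by (simp add: inverse_eq_divide)
  have "Cauchy f"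
  proof (rule CauchyI)
    fix e :: real assume e: "0 < e"
    have "(\<lambda>n. (d + 1 / real (Suc n))\<^sup>2) \<longlonglongrightarrow> d\<^sup>2"
      by (intro tendsto_intros lim)
    \<comment> \<open>With excess below \<open>e\<^sup>2 / 4\<close> in both squares, the bound in
      \<open>key\<close> drops below \<open>e\<^sup>2\<close>.\<close>
    moreover have "d\<^sup>2 < d\<^sup>2 + e\<^sup>2 / 4" using e by simp
    ultimately have "\<forall>\<^sub>F n in sequentially. (d + 1 / real (Suc n))\<^sup>2 < d\<^sup>2 + e\<^sup>2 / 4"
      by (rule order_tendstoD)
    then obtain N where N: "\<And>n. n \<ge> N \<Longrightarrow> (d + 1 / real (Suc n))\<^sup>2 < d\<^sup>2 + e\<^sup>2 / 4"
      by (auto simp: eventually_sequentially)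
    show "\<exists>N. \<forall>m\<ge>N. \<forall>n\<ge>N. norm (f m - f n) < e"
    proof (intro exI[of _ N] allI impI)
      fix m n assume "m \<ge> N" "n \<ge> N"
      then have "(norm (f m - f n))\<^sup>2 < e\<^sup>2" using key[of m n] N[of m] N[of n] by linarith
      then show "norm (f m - f n) < e" by (rule power2_less_imp_less) (use e in simp)
    qed
  qed
  then obtain y where y: "f \<longlonglongrightarrow> y" by (meson Cauchy_convergent convergent_def)
  have "y \<in> M" using closed_sequentially[OF cl fM y] .
  moreover have "norm (x - y) \<le> d"
  proof (rule LIMSEQ_le[OF _ lim])
    show "(\<lambda>n. norm (x - f n)) \<longlonglongrightarrow> norm (x - y)" by (intro tendsto_intros y)
    show "\<exists>N. \<forall>n\<ge>N. norm (x - f n) \<le> d + 1 / real (Suc n)" using f less_imp_le by blast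
  qed
  ultimately show ?thesis using d_le order_trans by blast
qed

text \<open>Take the nearest point \<open>y\<close>. Removing from \<open>x - y\<close> its
  component along \<open>z\<close> cannot shorten it, so by Pythagoras that component
  vanishes.\<close>

lemma projection_exists:
  fixes x :: "'a :: chilbert_space"
  assumes M: "closed_csubspace M"
  shows "\<exists>y\<in>M. \<forall>z\<in>M. cinner (x - y) z = 0"
proof -
  have sub: "csubspace M" using M by (simp add: closed_csubspace_def)
  obtain y where y: "y \<in> M" and min: "\<And>z. z \<in> M \<Longrightarrow> norm (x - y) \<le> norm (x - z)"
    using nearest_point_exists[OF M] by blast
  have "cinner (x - y) z = 0" if z: "z \<in> M" for z
  proof (cases "z = 0")
    case False
    define t where "t = cinner (x - y) z / cinner z z"
    have "y + t *\<^sub>C z \<in> M"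
      using y z sub by (simp add: complex_vector.subspace_add complex_vector.subspace_scale)
    then have "norm (x - y) \<le> norm ((x - y) - t *\<^sub>C z)" using min by (simp add: diff_diff_add)
    then have "(norm (x - y))\<^sup>2 \<le> (norm ((x - y) - t *\<^sub>C z))\<^sup>2" by (rule power_mono) simp
    then have "(cmod (cinner (x - y) z))\<^sup>2 / (norm z)\<^sup>2 \<le> 0"
      using norm_diff_component_sq[OF False, of "x - y"] by (simp add: t_def)
    then show ?thesis using False by (simp add: divide_le_0_iff)
  qed simp
  then show ?thesis using y by blast
qed

lemma oproj_works:
  fixes x :: "'a :: chilbert_space"
  assumes M: "closed_csubspace M"
  shows "oproj M x \<in> M \<and> (\<forall>z\<in>M. cinner (x - oproj M x) z = 0)"
proof -
  have sub: "csubspace M" using M by (simp add: closed_csubspace_def)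
  have "\<exists>!y. y \<in> M \<and> (\<forall>z\<in>M. cinner (x - y) z = 0)"
  proof (rule ex_ex1I)
    show "\<exists>y. y \<in> M \<and> (\<forall>z\<in>M. cinner (x - y) z = 0)" using projection_exists[OF M] by blast
  next
    fix y y' assume *: "y \<in> M \<and> (\<forall>z\<in>M. cinner (x - y) z = 0)"
      "y' \<in> M \<and> (\<forall>z\<in>M. cinner (x - y') z = 0)"
    \<comment> \<open>Uniqueness: the difference of two candidates lies in \<open>M\<close> and is
      orthogonal to itself.\<close>
    then have "y - y' \<in> M" using sub by (simp add: complex_vector.subspace_diff)
    then have "cinner (x - y') (y - y') - cinner (x - y) (y - y') = 0" using * by simp
    then have "cinner (y - y') (y - y') = 0" by (simp add: cinner_diff_left[symmetric])
    then show "y = y'" by simp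
  qed
  then show ?thesis unfolding oproj_def by (rule theI')
qed

text \<open>Allows the projected orbit to be replaced by the orbit itself in frame sums at vectors
  of \<open>M\<close>.\<close>

lemma cinner_oproj:
  fixes v :: "'a :: chilbert_space"
  assumes "closed_csubspace M" "y \<in> M"
  shows "cinner y (oproj M v) = cinner y v"
proof -
  have "cinner (v - oproj M v) y = 0" using oproj_works[OF assms(1)] assms(2) by blast
  then have "cinner y (v - oproj M v) = 0" by (simp add: cinner_eq_zero_commute)
  then show ?thesis by (simp add: cinner_diff_right)
qed

text \<open>For nonzero \<open>f\<close>, a vector \<open>v\<close> orthogonal to the kernel with
  \<open>f v \<noteq> 0\<close> represents \<open>f\<close> up to a scalar.\<close>

lemma riesz_representation:
  fixes f :: "'a :: chilbert_space \<Rightarrow> complex"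
  assumes bl: "bounded_linear f" and hom: "\<And>c x. f (c *\<^sub>C x) = c * f x"
  shows "\<exists>y. \<forall>x. f x = cinner x y"
proof (cases "\<forall>x. f x = 0")
  case True
  then show ?thesis by (intro exI[of _ 0]) simp
next
  case False
  then obtain u where u: "f u \<noteq> 0" by blast
  interpret bounded_linear f by (rule bl)
  define K where "K = {x. f x = 0}"
  have "closed K"
    unfolding K_def by (intro closed_Collect_eq continuous_intros continuous_on)
  moreover have "csubspace K"
    by (simp add: K_def complex_vector.subspace_def zero add hom)
  ultimately obtain p where p: "p \<in> K" and orth: "\<And>z. z \<in> K \<Longrightarrow> cinner (u - p) z = 0"
    using projection_exists[of K u] by (auto simp: closed_csubspace_def)
  define v where "v = u - p"
  have fv: "f v \<noteq> 0" using p u by (simp add: v_def diff K_def)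
  then have "v \<noteq> 0" using zero by metis
  then have vv: "cinner v v \<noteq> 0" by simp
  have "f x = cinner x (cnj (f v / cinner v v) *\<^sub>C v)" for x
  proof -
    \<comment> \<open>This combination is annihilated by \<open>f\<close>, so it is orthogonal to
      \<open>v\<close>; solving for \<open>f x\<close> gives the scalar above.\<close>
    have "f x *\<^sub>C v - f v *\<^sub>C x \<in> K" by (simp add: K_def diff hom)
    then have "cinner (f x *\<^sub>C v - f v *\<^sub>C x) v = 0"
      using orth cinner_eq_zero_commute by (metis v_def)
    then have "f x * cinner v v = f v * cinner x v"
      by (simp add: cinner_diff_left cinner_scaleC_left)
    then show ?thesis using vv by (simp add: cinner_scaleC_right field_simps)
  qed
  then show ?thesis by blast
qed

text \<open>Riesz applied to \<open>\<lambda>x. cinner (A x) y\<close> for each \<open>y\<close>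
  supplies the adjoint; the definite description is legitimate because a vector is determined by its
  inner products.\<close>

lemma cinner_cadjoint:
  fixes A :: "'a :: chilbert_space \<Rightarrow> 'b :: complex_inner"
  assumes "bounded_clinear A"
  shows "cinner (A x) y = cinner x (cadjoint A y)"
proof -
  have bl: "bounded_linear A" and hom: "\<And>c x. A (c *\<^sub>C x) = c *\<^sub>C A x"
    using assms by (auto simp: bounded_clinear_def)
  have "\<exists>b. \<forall>x. cinner (A x) y = cinner x b" for y
    by (rule riesz_representation)
      (auto simp: hom cinner_scaleC_left
        intro: bounded_linear_compose[OF bounded_linear_cinner_left bl])
  then obtain B where B: "\<And>x y. cinner (A x) y = cinner x (B y)" by metis
  have "cadjoint A = B"
    unfolding cadjoint_def
  proof (rule the_equality)
    show "\<forall>x y. cinner (A x) y = cinner x (B y)" using B by blast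
  next
    fix B' assume "\<forall>x y. cinner (A x) y = cinner x (B' y)"
    then show "B' = B" using B by (intro ext cinner_ext_right) metis
  qed
  then show ?thesis using B by simp
qed

lemma cinner_cadjoint_funpow:
  fixes A :: "'a :: chilbert_space \<Rightarrow> 'a"
  assumes "bounded_clinear A"
  shows "cinner ((A ^^ k) u) y = cinner u ((cadjoint A ^^ k) y)"
proof (induction k arbitrary: y)
  case (Suc k)
  have "cinner ((A ^^ Suc k) u) y = cinner ((A ^^ k) u) (cadjoint A y)"
    by (simp add: cinner_cadjoint[OF assms])
  also have "\<dots> = cinner u ((cadjoint A ^^ Suc k) y)"
    by (simp add: Suc.IH funpow_swap1)
  finally show ?case .
qed simp

lemma normal_cadjoint_commute:
  assumes "normal_operator A"
  shows "A (cadjoint A y) = cadjoint A (A y)"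
  using assms by (metis comp_apply normal_operator_def)

text \<open>Both squared norms are inner products of \<open>y\<close> with
  \<open>cadjoint A (A y) = A (cadjoint A y)\<close>, up to conjugation.\<close>

lemma norm_cadjoint_normal:
  fixes A :: "'a :: chilbert_space \<Rightarrow> 'a"
  assumes A: "normal_operator A"
  shows "norm (cadjoint A y) = norm (A y)"
proof -
  have bl: "bounded_clinear A" using A by (simp add: normal_operator_def)
  have "complex_of_real ((norm (A y))\<^sup>2) = cinner y (cadjoint A (A y))"
    by (simp only: cinner_self[symmetric] cinner_cadjoint[OF bl])
  also have "\<dots> = cnj (cinner (A (cadjoint A y)) y)"
    by (metis normal_cadjoint_commute[OF A] cinner_commute)
  also have "\<dots> = complex_of_real ((norm (cadjoint A y))\<^sup>2)"
    by (simp add: cinner_cadjoint[OF bl] cinner_self)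
  finally have "(norm (A y))\<^sup>2 = (norm (cadjoint A y))\<^sup>2"
    using of_real_eq_iff by blast
  then show ?thesis by (simp add: power2_eq_iff_nonneg)
qed

lemma norm_cadjoint_funpow_normal:
  fixes A :: "'a :: chilbert_space \<Rightarrow> 'a"
  assumes A: "normal_operator A"
  shows "norm ((cadjoint A ^^ k) y) = norm ((A ^^ k) y)"
proof (induction k arbitrary: y)
  case (Suc k)
  \<comment> \<open>Commuting \<open>A\<close> past the adjoint powers lets the induction trade one
    adjoint factor for \<open>A\<close> at a time.\<close>
  have comm: "A ((cadjoint A ^^ k) y) = (cadjoint A ^^ k) (A y)"
    by (induction k) (simp_all add: normal_cadjoint_commute[OF A])
  show ?case
    by (simp add: norm_cadjoint_normal[OF A] comm Suc.IH funpow_swap1[of A])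
qed simp

section \<open>Growth of orbits of a normal operator\<close>

text \<open>Move one \<open>A\<close> across the inner product in the squared norm of
  \<open>A u\<close>, apply Cauchy-Schwarz, and replace the adjoint by \<open>A\<close> inside the
  norm.\<close>

lemma normal_orbit_log_convex:
  fixes A :: "'a :: chilbert_space \<Rightarrow> 'a"
  assumes A: "normal_operator A"
  shows "(norm ((A ^^ Suc n) x))\<^sup>2 \<le> norm ((A ^^ n) x) * norm ((A ^^ Suc (Suc n)) x)"
proof -
  have bl: "bounded_clinear A" using A by (simp add: normal_operator_def)
  let ?u = "(A ^^ n) x"
  have "complex_of_real ((norm (A ?u))\<^sup>2) = cinner ?u (cadjoint A (A ?u))"
    by (simp only: cinner_self[symmetric] cinner_cadjoint[OF bl])
  then have "(norm (A ?u))\<^sup>2 = cmod (cinner ?u (cadjoint A (A ?u)))"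
    by (metis norm_of_real abs_of_nonneg zero_le_power2)
  also have "\<dots> \<le> norm ?u * norm (cadjoint A (A ?u))" by (rule cmod_cinner_le)
  finally show ?thesis by (simp add: norm_cadjoint_normal[OF A])
qed

text \<open>Log-convexity means that the ratios \<open>w (Suc n) / w n\<close> never decrease. So
  one step that does not go down makes the sequence nondecreasing from there on; otherwise it
  decreases throughout.\<close>

lemma log_convex_trichotomy:
  fixes w :: "nat \<Rightarrow> real"
  assumes pos: "\<And>n. 0 < w n" and conv: "\<And>n. (w (Suc n))\<^sup>2 \<le> w n * w (Suc (Suc n))"
  obtains "w \<longlonglongrightarrow> 0" | "filterlim w at_top sequentially"
    | c C where "0 < c" "\<And>n. c \<le> w n" "\<And>n. w n \<le> C"
proof (cases "\<exists>N. w N \<le> w (Suc N)")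
  case True
  then obtain N where N: "w N \<le> w (Suc N)" by blast
  have step: "w (N + k) \<le> w (Suc (N + k))" for k
  proof (induction k)
    case (Suc k)
    let ?m = "N + k"
    \<comment> \<open>The previous step replaces \<open>w ?m\<close> by \<open>w (Suc ?m)\<close>,
      which is then cancelled.\<close>
    have "w (Suc ?m) * w (Suc ?m) \<le> w ?m * w (Suc (Suc ?m))"
      using conv[of ?m] by (simp add: power2_eq_square)
    also have "\<dots> \<le> w (Suc ?m) * w (Suc (Suc ?m))"
      by (rule mult_right_mono) (use Suc pos less_imp_le in auto)
    finally show ?case using pos[of "Suc ?m"] by simp
  qed (use N in simp)
  define v where "v k = w (k + N)" for k
  have inc: "incseq v" using step by (intro incseq_SucI) (simp add: v_def add.commute)
  show ?thesis
  proof (cases "\<exists>C. \<forall>k. v k \<le> C")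
    case False
    have "filterlim v at_top sequentially"
      unfolding filterlim_at_top eventually_sequentially
    proof
      fix Z
      obtain k where "Z \<le> v k" using False by (meson linear)
      then show "\<exists>N. \<forall>n\<ge>N. Z \<le> v n" using inc by (meson incseqD order_trans)
    qed
    then have "filterlim w at_top sequentially"
      unfolding v_def filterlim_def le_filter_def eventually_filtermap
      using eventually_sequentially_seg by blast
    then show ?thesis by (rule that(2))
  next
    case True
    then obtain C where C: "\<And>k. v k \<le> C" by blast
    \<comment> \<open>The finitely many values up to \<open>N\<close> precede the monotone regime
      and enter the constants through \<open>Min\<close> and \<open>Max\<close>.\<close>
    let ?S = "w ` {..N}"
    have tail: "v 0 \<le> w n \<and> w n \<le> C" if "n \<ge> N" for n
    proof -
      have "w n = v (n - N)" using that by (simp add: v_def)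
      then show ?thesis using C incseqD[OF inc, of 0 "n - N"] by simp
    qed
    show ?thesis
    proof (rule that(3)[of "Min ?S" "max C (Max ?S)"])
      show "0 < Min ?S" using pos by simp
      show "Min ?S \<le> w n" for n
      proof (cases "n \<le> N")
        case False
        then have "w N \<le> w n" using tail[of n] by (simp add: v_def)
        moreover have "Min ?S \<le> w N" by simp
        ultimately show ?thesis by linarith
      qed simp
      show "w n \<le> max C (Max ?S)" for n
      proof (cases "n \<le> N")
        case True
        then have "w n \<le> Max ?S" by (intro Max_ge) auto
        then show ?thesis by simp
      qed (use tail[of n] in \<open>simp add: le_max_iff_disj\<close>)
    qed
  qed
next
  case False
  then have dec: "decseq w" by (intro decseq_SucI) (meson linear)
  obtain l where l: "w \<longlonglongrightarrow> l" and ge: "\<And>n. l \<le> w n"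
    using decseq_convergent[OF dec, of 0] pos less_imp_le by metis
  \<comment> \<open>A zero limit is the first alternative; a positive limit serves as the lower
    constant in the third.\<close>
  show ?thesis
  proof (cases "l = 0")
    case True
    then show ?thesis using l that(1) by simp
  next
    case False
    have "0 \<le> l" using l pos less_imp_le by (meson LIMSEQ_le_const)
    then have "0 < l" using False by simp
    then show ?thesis using that(3)[OF _ ge] decseqD[OF dec] by blast
  qed
qed

subsection \<open>Finite dimension\<close>

text \<open>The kernel of a functional has codimension at most one, so a finite spanning set of it,
  enlarged by one vector \<open>u\<close> outside it, would span \<open>M\<close>.\<close>

lemma not_cfinite_dim_kernel:
  fixes M :: "'a :: complex_inner set"
  assumes sub: "csubspace M" and nf: "\<not> cfinite_dim M"
  shows "csubspace {y \<in> M. cinner y v = 0} \<and> \<not> cfinite_dim {y \<in> M. cinner y v = 0}"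
    (is "csubspace ?K \<and> _")
proof
  show "csubspace ?K"
    using sub by (simp add: complex_vector.subspace_def cinner_add_left cinner_scaleC_left)
  show "\<not> cfinite_dim ?K"
  proof
    assume "cfinite_dim ?K"
    then obtain B where B: "finite B" "B \<subseteq> ?K" "cspan B = ?K" by (auto simp: cfinite_dim_def)
    have "?K \<noteq> M" using B nf by (auto simp: cfinite_dim_def)
    then obtain u where u: "u \<in> M" "cinner u v \<noteq> 0" by blast
    have "y \<in> cspan (insert u B)" if "y \<in> M" for y
    proof -
      \<comment> \<open>Chosen so that \<open>y - ?k *\<^sub>C u\<close> is orthogonal to
        \<open>v\<close>.\<close>
      let ?k = "cinner y v / cinner u v"
      have "y - ?k *\<^sub>C u \<in> ?K"
        using u that sub
        by (simp add: complex_vector.subspace_diff complex_vector.subspace_scale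
            cinner_diff_left cinner_scaleC_left)
      then have "y - ?k *\<^sub>C u \<in> cspan B" by (simp only: B(3))
      then show ?thesis unfolding complex_vector.span_insert by blast
    qed
    moreover have "cspan (insert u B) \<subseteq> M"
      by (rule complex_vector.span_minimal) (use u B sub in auto)
    ultimately have "cspan (insert u B) = M" by blast
    moreover have "insert u B \<subseteq> M" using u B by blast
    ultimately show False using nf B(1) unfolding cfinite_dim_def by blast
  qed
qed

text \<open>Imposing the conditions one at a time keeps the subspace infinite-dimensional, hence
  nonzero.\<close>

lemma exists_orthogonal_to_finitely_many:
  fixes M :: "'a :: complex_inner set" and v :: "nat \<Rightarrow> 'a"
  assumes "csubspace M" "\<not> cfinite_dim M"
  shows "\<exists>y\<in>M. y \<noteq> 0 \<and> (\<forall>n<N. cinner y (v n) = 0)"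
proof -
  let ?K = "\<lambda>N. {y \<in> M. \<forall>n<N. cinner y (v n) = 0}"
  have K: "csubspace (?K N) \<and> \<not> cfinite_dim (?K N)"
  proof (induction N)
    case (Suc N)
    have "?K (Suc N) = {y \<in> ?K N. cinner y (v N) = 0}" by (auto simp: less_Suc_eq)
    then show ?case using not_cfinite_dim_kernel[of "?K N" "v N"] Suc by presburger
  qed (use assms in simp)
  have "cfinite_dim ({0} :: 'a set)"
    unfolding cfinite_dim_def by (intro exI[of _ "{}"]) simp
  then have "?K N \<noteq> {0}" using K by metis
  moreover have "0 \<in> ?K N" using K complex_vector.subspace_0 by blast
  ultimately show ?thesis by blast
qed

text \<open>The vectors are left unnormalized; excluding \<open>0\<close> is what makes division by
  \<open>cinner e e\<close> meaningful.\<close>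

lemma gram_schmidt:
  fixes B :: "'a :: complex_inner set"
  assumes "finite B"
  shows "\<exists>E. finite E \<and> cspan E = cspan B \<and> 0 \<notin> E \<and>
    (\<forall>e\<in>E. \<forall>e'\<in>E. e \<noteq> e' \<longrightarrow> cinner e e' = 0)"
  using assms
proof (induction B)
  case empty
  show ?case by (intro exI[of _ "{}"]) simp
next
  case (insert b B)
  then obtain E where E: "finite E" "cspan E = cspan B" "0 \<notin> E"
    and orth: "\<And>e e'. e \<in> E \<Longrightarrow> e' \<in> E \<Longrightarrow> e \<noteq> e' \<Longrightarrow> cinner e e' = 0" by blast
  define s where "s = (\<Sum>e\<in>E. (cinner b e / cinner e e) *\<^sub>C e)"
  define q where "q = b - s"
  have s: "s \<in> cspan E"
    unfolding s_def
    by (intro complex_vector.span_sum complex_vector.span_scale complex_vector.span_base)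
  have q: "cinner q e = 0" if e: "e \<in> E" for e
  proof -
    \<comment> \<open>Orthogonality leaves only the term at \<open>e\<close>, so \<open>s\<close>
      and \<open>b\<close> have the same inner product with \<open>e\<close>.\<close>
    have "cinner s e = (\<Sum>e'\<in>E. if e' = e then cinner b e else 0)"
      unfolding s_def cinner_sum_left
      by (rule sum.cong) (use e E(3) orth in \<open>auto simp: cinner_scaleC_left\<close>)
    then show ?thesis using E(1) e by (simp add: q_def cinner_diff_left)
  qed
  have span: "cspan (insert q E) = cspan (insert b B)"
  proof -
    have s_ins: "s \<in> cspan (insert a E)" for a
      using s complex_vector.span_mono[OF subset_insertI] by (rule rev_subsetD)
    have "cspan (insert q E) = cspan (insert b E)"
    proof (rule subset_antisym)
      have "q \<in> cspan (insert b E)" unfolding q_def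
        by (rule complex_vector.span_diff[OF complex_vector.span_base s_ins]) simp
      then show "cspan (insert q E) \<subseteq> cspan (insert b E)"
        by (intro complex_vector.span_minimal complex_vector.subspace_span)
          (auto intro: complex_vector.span_base)
      have "q + s \<in> cspan (insert q E)"
        by (rule complex_vector.span_add[OF complex_vector.span_base s_ins]) simp
      then have "b \<in> cspan (insert q E)" by (simp add: q_def)
      then show "cspan (insert b E) \<subseteq> cspan (insert q E)"
        by (intro complex_vector.span_minimal complex_vector.subspace_span)
          (auto intro: complex_vector.span_base)
    qed
    also have "\<dots> = cspan (insert b B)"
      using E(2) by (simp add: complex_vector.span_insert)
    finally show ?thesis .
  qed
  show ?case
  proof (cases "q = 0")
    \<comment> \<open>Here \<open>b\<close> already lies in the span, so \<open>E\<close> is kept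
      unchanged.\<close>
    case True
    then have "cspan E = cspan (insert b B)" using span complex_vector.span_insert_0 by metis
    then show ?thesis using E orth by blast
  next
    case False
    have "\<forall>e\<in>insert q E. \<forall>e'\<in>insert q E. e \<noteq> e' \<longrightarrow> cinner e e' = 0"
      using orth q cinner_eq_zero_commute by blast
    then show ?thesis using E(1,3) False span by (intro exI[of _ "insert q E"]) auto
  qed
qed

text \<open>In a finite orthogonal basis the norm is dominated by a fixed weighted sum of the moduli
  of the coordinates, each of which tends to \<open>0\<close>.\<close>

lemma weakly_null_in_finite_span:
  fixes z :: "nat \<Rightarrow> 'a :: complex_inner"
  assumes fin: "finite B" and z: "\<And>n. z n \<in> cspan B"
    and weak: "\<And>y. (\<lambda>n. cinner y (z n)) \<longlonglongrightarrow> 0"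
  shows "z \<longlonglongrightarrow> 0"
proof -
  obtain E where E: "finite E" "cspan E = cspan B" "0 \<notin> E"
    and orth: "\<And>e e'. e \<in> E \<Longrightarrow> e' \<in> E \<Longrightarrow> e \<noteq> e' \<Longrightarrow> cinner e e' = 0"
    using gram_schmidt[OF fin] by blast
  have expand: "v = (\<Sum>e\<in>E. (cinner v e / cinner e e) *\<^sub>C e)" if v_in: "v \<in> cspan E" for v
  proof -
    obtain r where v: "v = (\<Sum>e\<in>E. r e *\<^sub>C e)"
      using v_in unfolding complex_vector.span_finite[OF E(1)] by (rule rangeE)
    have "cinner v e = r e * cinner e e" if e: "e \<in> E" for e
    proof -
      have "cinner v e = (\<Sum>e'\<in>E. if e' = e then r e * cinner e e else 0)"
        unfolding v cinner_sum_left
        by (rule sum.cong) (use e orth in \<open>auto simp: cinner_scaleC_left\<close>)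
      then show ?thesis using E(1) e by simp
    qed
    then have "(\<Sum>e\<in>E. (cinner v e / cinner e e) *\<^sub>C e) = (\<Sum>e\<in>E. r e *\<^sub>C e)"
      using E(3) by (intro sum.cong) auto
    then show ?thesis using v by simp
  qed
  have "(\<lambda>n. \<Sum>e\<in>E. cmod (cinner e (z n)) / cmod (cinner e e) * norm e)
      \<longlonglongrightarrow> (\<Sum>e\<in>E. cmod 0 / cmod (cinner e e) * norm e)"
    using E(3) by (intro tendsto_intros weak) auto
  then have lim: "(\<lambda>n. \<Sum>e\<in>E. cmod (cinner e (z n)) / cmod (cinner e e) * norm e) \<longlonglongrightarrow> 0"
    by simp
  show ?thesis
  proof (rule Lim_null_comparison[OF _ lim], rule always_eventually, rule allI)
    fix n
    have "norm (z n) = norm (\<Sum>e\<in>E. (cinner (z n) e / cinner e e) *\<^sub>C e)"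
      using expand z E(2) by simp
    also have "\<dots> \<le> (\<Sum>e\<in>E. norm ((cinner (z n) e / cinner e e) *\<^sub>C e))" by (rule norm_sum)
    also have "\<dots> = (\<Sum>e\<in>E. cmod (cinner e (z n)) / cmod (cinner e e) * norm e)"
      by (simp add: norm_scaleC norm_divide cmod_cinner_commute)
    finally show "norm (z n) \<le> (\<Sum>e\<in>E. cmod (cinner e (z n)) / cmod (cinner e e) * norm e)" .
  qed
qed

subsection \<open>Frame sums\<close>

lemma frame_sum_mono:
  assumes "\<And>n. n \<in> I \<Longrightarrow> cmod (cinner y (u n)) \<le> cmod (cinner y (v n))"
  shows "frame_sum I u y \<le> frame_sum I v y"
  unfolding frame_sum_def
  by (intro infsum_mono nonneg_summable_on_complete ennreal_leI power_mono) (use assms in auto)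

lemma frame_sum_cong:
  assumes "\<And>n. n \<in> I \<Longrightarrow> cinner y (u n) = cinner y (v n)"
  shows "frame_sum I u y = frame_sum I v y"
  unfolding frame_sum_def by (rule infsum_cong) (simp add: assms)

lemma frame_sum_Un_disjoint:
  assumes "I \<inter> J = {}"
  shows "frame_sum (I \<union> J) u y = frame_sum I u y + frame_sum J u y"
  unfolding frame_sum_def
  by (intro infsum_Un_disjoint nonneg_summable_on_complete assms) auto

text \<open>Gives access to ordinary series and their tails.\<close>

lemma frame_sum_nat: "frame_sum UNIV u y = (\<Sum>n. ennreal ((cmod (cinner y (u n)))\<^sup>2))"
  unfolding frame_sum_def
  by (intro sums_unique has_sum_imp_sums has_sum_infsum nonneg_summable_on_complete) auto

lemma frame_sum_scaleR:
  "frame_sum (UNIV :: nat set) (\<lambda>n. r *\<^sub>R u n) y = ennreal (r\<^sup>2) * frame_sum UNIV u y"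
  unfolding frame_sum_nat
  by (simp add: cinner_scaleR_right norm_mult power_mult_distrib ennreal_mult)

lemma frame_sum_nat_summable:
  assumes "frame_sum UNIV u y \<le> ennreal c"
  shows "summable (\<lambda>n. (cmod (cinner y (u n)))\<^sup>2)"
  using assms unfolding frame_sum_nat
  by (intro summable_suminf_not_top) (auto simp: top_unique)

text \<open>At a nonzero \<open>y\<close> in \<open>M\<close> orthogonal to the first
  \<open>N\<close> members, only indices with small \<open>r n\<close> contribute, so the sum for
  \<open>v\<close> is a small multiple of the sum for \<open>u\<close>.\<close>

lemma no_lower_bound_of_null_multiple:
  fixes u v :: "nat \<Rightarrow> 'a :: complex_inner"
  assumes M: "csubspace M" "\<not> cfinite_dim M"
    and L: "0 < L" and lower: "\<And>y. y \<in> M \<Longrightarrow> ennreal (L * (norm y)\<^sup>2) \<le> frame_sum UNIV v y"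
    and upper: "\<And>y. y \<in> M \<Longrightarrow> frame_sum UNIV u y \<le> ennreal (L' * (norm y)\<^sup>2)"
    and v: "\<And>n. v n = r n *\<^sub>R u n" and r: "r \<longlonglongrightarrow> 0"
  shows False
proof -
  \<comment> \<open>Makes \<open>e\<^sup>2 * \<bar>L'\<bar> < L\<close>. The absolute value is there
    because \<open>L'\<close> may have any sign, and the added \<open>1\<close> keeps the
    denominator positive.\<close>
  define e where "e = sqrt (L / (2 * (\<bar>L'\<bar> + 1)))"
  have e0: "0 < e" using L by (simp add: e_def)
  have e2: "e\<^sup>2 * \<bar>L'\<bar> < L"
  proof -
    have "e\<^sup>2 = L / (2 * (\<bar>L'\<bar> + 1))" using L by (simp add: e_def)
    then have "e\<^sup>2 * \<bar>L'\<bar> = L * (\<bar>L'\<bar> / (2 * (\<bar>L'\<bar> + 1)))" by simp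
    also have "\<dots> < L * 1"
      by (rule mult_strict_left_mono[OF _ L]) (simp add: field_simps)
    finally show ?thesis by simp
  qed
  obtain N where N: "\<And>n. n \<ge> N \<Longrightarrow> \<bar>r n\<bar> < e"
    using LIMSEQ_D[OF r e0] by auto
  obtain y where y: "y \<in> M" "y \<noteq> 0" "\<And>n. n < N \<Longrightarrow> cinner y (v n) = 0"
    using exists_orthogonal_to_finitely_many[OF M, of N v] by blast
  \<comment> \<open>Below \<open>N\<close> the left side is \<open>0\<close> by the choice of
    \<open>y\<close>; from \<open>N\<close> on, \<open>\<bar>r n\<bar> < e\<close>.\<close>
  have "cmod (cinner y (v n)) \<le> cmod (cinner y (e *\<^sub>R u n))" for n
  proof (cases "n < N")
    case False
    then have "\<bar>r n\<bar> \<le> \<bar>e\<bar>" using N[of n] e0 by simp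
    then show ?thesis
      by (simp add: v cinner_scaleR_right norm_mult mult_right_mono)
  qed (simp add: y)
  then have "frame_sum UNIV v y \<le> ennreal (e\<^sup>2) * frame_sum UNIV u y"
    using frame_sum_mono[of UNIV y v "\<lambda>n. e *\<^sub>R u n"] by (simp add: frame_sum_scaleR)
  also have "\<dots> \<le> ennreal (e\<^sup>2) * ennreal (\<bar>L'\<bar> * (norm y)\<^sup>2)"
  proof (rule mult_left_mono)
    have "frame_sum UNIV u y \<le> ennreal (L' * (norm y)\<^sup>2)" by (rule upper[OF y(1)])
    also have "\<dots> \<le> ennreal (\<bar>L'\<bar> * (norm y)\<^sup>2)" by (intro ennreal_leI mult_right_mono) auto
    finally show "frame_sum UNIV u y \<le> ennreal (\<bar>L'\<bar> * (norm y)\<^sup>2)" .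
  qed simp
  also have "\<dots> = ennreal (e\<^sup>2 * \<bar>L'\<bar> * (norm y)\<^sup>2)"
    by (simp add: ennreal_mult[symmetric] mult.assoc)
  finally have "ennreal (L * (norm y)\<^sup>2) \<le> ennreal (e\<^sup>2 * \<bar>L'\<bar> * (norm y)\<^sup>2)"
    using lower[OF y(1)] by (rule order_trans[rotated])
  then have "L * (norm y)\<^sup>2 \<le> e\<^sup>2 * \<bar>L'\<bar> * (norm y)\<^sup>2" by (simp add: ennreal_le_iff)
  then show False using e2 y(2) by simp
qed

section \<open>Frame bounds along a normal orbit\<close>

text \<open>Testing on the \<open>k\<close>-th adjoint power at \<open>x\<close> shifts the series
  of \<open>a\<close> by \<open>k\<close>. The frame sum there is a tail of a convergent series,
  while normality makes the norm of the test vector that of \<open>(A ^^ k) x\<close>.\<close>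

lemma normal_orbit_frame_tendsto_zero:
  fixes A :: "'a :: chilbert_space \<Rightarrow> 'a"
  assumes A: "normal_operator A" and l: "0 < l"
    and lower: "\<And>y. ennreal (l * (norm y)\<^sup>2) \<le> frame_sum UNIV (\<lambda>n. (A ^^ n) x) y"
    and upper: "\<And>y. frame_sum UNIV (\<lambda>n. (A ^^ n) x) y \<le> ennreal (L * (norm y)\<^sup>2)"
  shows "(\<lambda>k. norm ((A ^^ k) x)) \<longlonglongrightarrow> 0"
proof -
  have bl: "bounded_clinear A" using A by (simp add: normal_operator_def)
  define a where "a n = (cmod (cinner x ((A ^^ n) x)))\<^sup>2" for n
  \<comment> \<open>This is the upper bound at \<open>y = x\<close>.\<close>
  have sm: "summable a" unfolding a_def by (rule frame_sum_nat_summable[OF upper])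
  have a0: "0 \<le> a n" for n by (simp add: a_def)
  have bound: "l * (norm ((A ^^ k) x))\<^sup>2 \<le> (\<Sum>n. a (n + k))" for k
  proof -
    have "frame_sum UNIV (\<lambda>n. (A ^^ n) x) ((cadjoint A ^^ k) x) = (\<Sum>n. ennreal (a (n + k)))"
    proof -
      have "cmod (cinner ((cadjoint A ^^ k) x) ((A ^^ n) x)) = cmod (cinner x ((A ^^ (n + k)) x))"
        for n
      proof -
        have "cmod (cinner ((cadjoint A ^^ k) x) ((A ^^ n) x))
            = cmod (cinner ((A ^^ n) x) ((cadjoint A ^^ k) x))"
          by (rule cmod_cinner_commute)
        also have "\<dots> = cmod (cinner ((A ^^ (k + n)) x) x)"
          by (simp add: cinner_cadjoint_funpow[OF bl, symmetric] funpow_add)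
        finally show ?thesis by (simp add: cmod_cinner_commute[of x] add.commute)
      qed
      then show ?thesis by (simp add: frame_sum_nat a_def)
    qed
    also have "\<dots> = ennreal (\<Sum>n. a (n + k))"
      by (intro suminf_ennreal2 a0 summable_ignore_initial_segment sm)
    finally have "ennreal (l * (norm ((A ^^ k) x))\<^sup>2) \<le> ennreal (\<Sum>n. a (n + k))"
      using lower[of "(cadjoint A ^^ k) x"] by (simp add: norm_cadjoint_funpow_normal[OF A])
    moreover have "0 \<le> (\<Sum>n. a (n + k))"
      by (intro suminf_nonneg a0 summable_ignore_initial_segment sm)
    ultimately show ?thesis by (simp add: ennreal_le_iff)
  qed
  have "(\<lambda>k. (\<Sum>n. a (n + k)) / l) \<longlonglongrightarrow> 0 / l"
    by (intro tendsto_divide tendsto_const suminf_exist_split2 sm) (use l in simp)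
  then have "(\<lambda>k. (\<Sum>n. a (n + k)) / l) \<longlonglongrightarrow> 0" by simp
  then have "(\<lambda>k. (norm ((A ^^ k) x))\<^sup>2) \<longlonglongrightarrow> 0"
    by (rule Lim_null_comparison[rotated])
      (use bound l in \<open>auto simp: field_simps intro!: always_eventually\<close>)
  then show ?thesis using tendsto_real_sqrt[of _ 0] by fastforce
qed

text \<open>The upper bound on \<open>M\<close> is only demanded for unbounded orbits, so that a contraction needs no
  upper bound at all.\<close>

lemma normalized_normal_orbit_not_frame:
  fixes A :: "'a :: chilbert_space \<Rightarrow> 'a"
  assumes A: "normal_operator A" and nz: "\<And>n. (A ^^ n) x \<noteq> 0"
    and M: "csubspace M" "\<not> cfinite_dim M"
    and L: "0 < L"
    and lower: "\<And>y. y \<in> M \<Longrightarrow> ennreal (L * (norm y)\<^sup>2) \<le> frame_sum UNIV (\<lambda>n. (A ^^ n) x) y"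
    and upper: "\<And>y. filterlim (\<lambda>n. norm ((A ^^ n) x)) at_top sequentially \<Longrightarrow> y \<in> M \<Longrightarrow>
      frame_sum UNIV (\<lambda>n. (A ^^ n) x) y \<le> ennreal (L' * (norm y)\<^sup>2)"
  shows "\<not> is_frame (UNIV :: nat set) (\<lambda>n. (A ^^ n) x /\<^sub>R norm ((A ^^ n) x)) UNIV"
proof
  define v where "v n = (A ^^ n) x" for n
  define w where "w n = norm (v n)" for n
  define z where "z n = v n /\<^sub>R w n" for n
  have w0: "0 < w n" for n using nz by (simp add: w_def v_def)
  assume "is_frame (UNIV :: nat set) (\<lambda>n. (A ^^ n) x /\<^sub>R norm ((A ^^ n) x)) UNIV"
  then obtain l l' where l: "0 < l" "l \<le> l'"
    and lz: "\<And>y. ennreal (l * (norm y)\<^sup>2) \<le> frame_sum UNIV z y"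
    and uz: "\<And>y. frame_sum UNIV z y \<le> ennreal (l' * (norm y)\<^sup>2)"
    unfolding is_frame_def z_def w_def v_def by auto
  have v_z: "v n = w n *\<^sub>R z n" and z_v: "z n = inverse (w n) *\<^sub>R v n" for n
    using w0[of n] by (simp_all add: z_def)
  have conv: "(w (Suc n))\<^sup>2 \<le> w n * w (Suc (Suc n))" for n
    unfolding w_def v_def by (rule normal_orbit_log_convex[OF A])
  show False
  proof (rule log_convex_trichotomy[of w, OF w0 conv])
    assume "w \<longlonglongrightarrow> 0"
    \<comment> \<open>The orbit is a null multiple of the normalized orbit: its lower bound on
      \<open>M\<close> meets the Bessel bound of the latter.\<close>
    then show False
      using no_lower_bound_of_null_multiple[OF M L lower[folded v_def] uz v_z] by blast
  next
    assume top: "filterlim w at_top sequentially"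
    then have "(\<lambda>n. inverse (w n)) \<longlonglongrightarrow> 0" by (rule tendsto_inverse_0_at_top)
    \<comment> \<open>The roles are exchanged: the normalized orbit is a null multiple of the orbit,
      whose upper bound on \<open>M\<close> is available since the norms diverge.\<close>
    then show False
      using no_lower_bound_of_null_multiple[OF M l(1) lz
          upper[folded v_def, OF top[unfolded w_def]] z_v] by blast
  next
    fix c C assume c: "0 < c" "\<And>n. c \<le> w n" and C: "\<And>n. w n \<le> C"
    have abs: "\<bar>c\<bar> \<le> \<bar>w n\<bar>" "\<bar>w n\<bar> \<le> \<bar>C\<bar>" for n
      using c(1) c(2)[of n] C[of n] by simp_all
    \<comment> \<open>Weights between \<open>c\<close> and \<open>C\<close> turn the frame bounds
      \<open>l\<close>, \<open>l'\<close> of \<open>z\<close> into \<open>c\<^sup>2 * l\<close>,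
      \<open>C\<^sup>2 * l'\<close> for the orbit, whose norms then tend to \<open>0\<close> despite
      staying above \<open>c\<close>.\<close>
    have "(\<lambda>k. norm ((A ^^ k) x)) \<longlonglongrightarrow> 0"
    proof (rule normal_orbit_frame_tendsto_zero[OF A])
      show "0 < c\<^sup>2 * l" using c l by simp
    next
      fix y
      have "ennreal (c\<^sup>2) * ennreal (l * (norm y)\<^sup>2) \<le> ennreal (c\<^sup>2) * frame_sum UNIV z y"
        by (intro mult_left_mono lz) simp
      also have "\<dots> \<le> frame_sum UNIV v y"
        unfolding frame_sum_scaleR[symmetric]
        by (rule frame_sum_mono)
          (use abs in \<open>simp add: v_z cinner_scaleR_right norm_mult mult_right_mono\<close>)
      finally show "ennreal (c\<^sup>2 * l * (norm y)\<^sup>2) \<le> frame_sum UNIV (\<lambda>n. (A ^^ n) x) y"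
        using l by (simp add: ennreal_mult[symmetric] mult.assoc v_def[abs_def])
    next
      fix y
      have "frame_sum UNIV v y \<le> ennreal (C\<^sup>2) * frame_sum UNIV z y"
        unfolding frame_sum_scaleR[symmetric]
        by (rule frame_sum_mono)
          (use abs in \<open>simp add: v_z cinner_scaleR_right norm_mult mult_right_mono\<close>)
      also have "\<dots> \<le> ennreal (C\<^sup>2) * ennreal (l' * (norm y)\<^sup>2)"
        by (intro mult_left_mono uz) simp
      finally show "frame_sum UNIV (\<lambda>n. (A ^^ n) x) y \<le> ennreal (C\<^sup>2 * l' * (norm y)\<^sup>2)"
        using l by (simp add: ennreal_mult[symmetric] mult.assoc v_def[abs_def])
    qed
    then have "c \<le> 0"
      using c(2) by (intro LIMSEQ_le_const) (auto simp: w_def v_def)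
    then show False using c(1) by simp
  qed
qed

section \<open>Finite-dimensional spans, finite index sets and closures\<close>

text \<open>A Bessel bound makes the coefficients against each \<open>y\<close> square-summable, so
  the family is weakly null and, in finite dimension, null in norm.\<close>

lemma unit_vectors_in_finite_span_not_Bessel:
  fixes z :: "nat \<Rightarrow> 'a :: complex_inner"
  assumes "finite B" and "\<And>n. z n \<in> cspan B" and unit: "\<And>n. norm (z n) = 1"
  shows "\<not> is_frame UNIV z UNIV"
proof
  assume "is_frame UNIV z UNIV"
  then obtain l where l: "\<And>y. frame_sum UNIV z y \<le> ennreal (l * (norm y)\<^sup>2)"
    unfolding is_frame_def by auto
  have "(\<lambda>n. cinner y (z n)) \<longlonglongrightarrow> 0" for y
  proof -
    have "(\<lambda>n. (cmod (cinner y (z n)))\<^sup>2) \<longlonglongrightarrow> 0"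
      by (intro summable_LIMSEQ_zero frame_sum_nat_summable[OF l])
    then have "(\<lambda>n. cmod (cinner y (z n))) \<longlonglongrightarrow> 0"
      using tendsto_real_sqrt[of _ 0] by fastforce
    then show ?thesis by (simp add: tendsto_norm_zero_iff)
  qed
  then have "z \<longlonglongrightarrow> 0" by (rule weakly_null_in_finite_span[OF assms(1,2)])
  then have "(\<lambda>n. norm (z n)) \<longlonglongrightarrow> 0" by (rule tendsto_norm_zero)
  then show False by (simp add: unit LIMSEQ_const_iff)
qed

text \<open>Termwise Cauchy-Schwarz; it controls the members restored when the indices in
  \<open>J\<close> are added back.\<close>

lemma frame_sum_finite_le:
  assumes "finite J"
  shows "frame_sum J u y \<le> ennreal ((\<Sum>j\<in>J. (norm (u j))\<^sup>2) * (norm y)\<^sup>2)"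
proof -
  have "frame_sum J u y = ennreal (\<Sum>j\<in>J. (cmod (cinner y (u j)))\<^sup>2)"
    using assms by (simp add: frame_sum_def)
  also have "\<dots> \<le> ennreal (\<Sum>j\<in>J. (norm (u j))\<^sup>2 * (norm y)\<^sup>2)"
  proof (intro ennreal_leI sum_mono)
    fix j
    have "(cmod (cinner y (u j)))\<^sup>2 \<le> (norm y * norm (u j))\<^sup>2"
      by (intro power_mono cmod_cinner_le) simp
    then show "(cmod (cinner y (u j)))\<^sup>2 \<le> (norm (u j))\<^sup>2 * (norm y)\<^sup>2"
      by (simp add: power_mult_distrib mult.commute)
  qed
  finally show ?thesis by (simp add: sum_distrib_right)
qed

lemma csubspace_closure:
  fixes S :: "'a :: complex_inner set"
  assumes S: "csubspace S"
  shows "csubspace (closure S)"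
proof (rule complex_vector.subspaceI)
  show "0 \<in> closure S" using complex_vector.subspace_0[OF S] closure_subset by blast
next
  fix x y assume "x \<in> closure S" "y \<in> closure S"
  then obtain f g where "\<And>n. f n \<in> S" "f \<longlonglongrightarrow> x" "\<And>n. g n \<in> S" "g \<longlonglongrightarrow> y"
    by (auto simp: closure_sequential)
  then show "x + y \<in> closure S"
    unfolding closure_sequential
    by (intro exI[of _ "\<lambda>n. f n + g n"] conjI allI tendsto_add complex_vector.subspace_add[OF S])
next
  fix c x assume "x \<in> closure S"
  then obtain f where f: "\<And>n. f n \<in> S" "f \<longlonglongrightarrow> x" by (auto simp: closure_sequential)
  have "bounded_linear (\<lambda>x :: 'a. c *\<^sub>C x)"
    by (rule bounded_linear_intro[of _ "cmod c"])
      (simp_all add: scaleC_add_right scaleR_scaleC scaleC_scaleC norm_scaleC mult.commute)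
  then have "(\<lambda>n. c *\<^sub>C f n) \<longlonglongrightarrow> c *\<^sub>C x"
    using f(2) by (rule bounded_linear.tendsto)
  then show "c *\<^sub>C x \<in> closure S"
    unfolding closure_sequential
    using f(1) by (intro exI[of _ "\<lambda>n. c *\<^sub>C f n"]) (simp add: complex_vector.subspace_scale[OF S])
qed

section \<open>Reduction of the three conditions to the orbit argument\<close>

theorem theorem5p10:
  fixes A :: "'a :: chilbert_space \<Rightarrow> 'a" and x :: 'a
  assumes "separable_space (euclidean :: 'a topology)"
    and "normal_operator A"
    and "\<And>n :: nat. (A ^^ n) x \<noteq> 0"
    and "(\<exists>M. closed_csubspace M \<and> \<not> cfinite_dim M \<and>
            is_frame (UNIV :: nat set) (\<lambda>n. oproj M ((A ^^ n) x)) M)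
       \<or> (onorm A \<le> 1 \<and>
          (\<exists>M. closed_csubspace M \<and> \<not> cfinite_dim M \<and>
            lower_frame_condition (UNIV :: nat set) (\<lambda>n. oproj M ((A ^^ n) x)) M))
       \<or> (\<exists>J :: nat set. finite J \<and>
            is_frame (UNIV - J) (\<lambda>n. (A ^^ n) x)
              (closure (cspan ((\<lambda>n. (A ^^ n) x) ` (UNIV - J)))))"
  shows "\<not> is_frame (UNIV :: nat set) (\<lambda>n. (A ^^ n) x /\<^sub>R norm ((A ^^ n) x)) (UNIV :: 'a set)"
proof -
  let ?v = "\<lambda>n. (A ^^ n) x"
  note core = normalized_normal_orbit_not_frame[OF assms(2,3)]
  have proj: "frame_sum UNIV (\<lambda>n. oproj M (?v n)) y = frame_sum UNIV ?v y"
    if "closed_csubspace M" "y \<in> M" for M y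
    by (rule frame_sum_cong) (rule cinner_oproj[OF that])
  from assms(4) consider
    (a) M where "closed_csubspace M" "\<not> cfinite_dim M" "is_frame UNIV (\<lambda>n. oproj M (?v n)) M"
    | (b) M where "onorm A \<le> 1" "closed_csubspace M" "\<not> cfinite_dim M"
        "lower_frame_condition UNIV (\<lambda>n. oproj M (?v n)) M"
    | (c) J where "finite J" "is_frame (UNIV - J) ?v (closure (cspan (?v ` (UNIV - J))))"
    by blast
  then show ?thesis
  proof cases
    case a
    then obtain L L' where L: "0 < L"
      and bounds: "\<And>y. y \<in> M \<Longrightarrow> ennreal (L * (norm y)\<^sup>2) \<le> frame_sum UNIV ?v y \<and>
        frame_sum UNIV ?v y \<le> ennreal (L' * (norm y)\<^sup>2)"
      unfolding is_frame_def by (auto simp: proj)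
    show ?thesis
    proof (rule core[OF _ a(2) L])
      show "csubspace M" using a(1) by (simp add: closed_csubspace_def)
    qed (use bounds in blast)+
  next
    case b
    then obtain L where L: "0 < L"
      and bound: "\<And>y. y \<in> M \<Longrightarrow> ennreal (L * (norm y)\<^sup>2) \<le> frame_sum UNIV ?v y"
      unfolding lower_frame_condition_def by (auto simp: proj)
    have bl: "bounded_linear A"
      using assms(2) by (simp add: normal_operator_def bounded_clinear_def)
    have contr: "norm (A u) \<le> norm u" for u
      using onorm[OF bl, of u] mult_right_mono[OF b(1), of "norm u"] by simp
    have bdd: "norm (?v n) \<le> norm x" for n
      by (induction n) (auto intro: order_trans[OF contr])
    \<comment> \<open>A contraction has a bounded orbit, so the upper bound required by
      \<open>core\<close> holds vacuously.\<close>
    have "\<not> filterlim (\<lambda>n. norm (?v n)) at_top sequentially"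
    proof
      assume "filterlim (\<lambda>n. norm (?v n)) at_top sequentially"
      then have "\<forall>\<^sub>F n in sequentially. norm x < norm (?v n)"
        by (simp add: filterlim_at_top_dense)
      then obtain n where "norm x < norm (?v n)" by (auto simp: eventually_sequentially)
      then show False using bdd[of n] by simp
    qed
    then show ?thesis
      using core[OF _ b(3) L bound] b(2) unfolding closed_csubspace_def by blast
  next
    case c
    define K where "K = closure (cspan (?v ` (UNIV - J)))"
    obtain L L' where L: "0 < L" "L \<le> L'"
      and bounds: "\<And>y. y \<in> K \<Longrightarrow> ennreal (L * (norm y)\<^sup>2) \<le> frame_sum (UNIV - J) ?v y \<and>
        frame_sum (UNIV - J) ?v y \<le> ennreal (L' * (norm y)\<^sup>2)"
      using c(2) unfolding is_frame_def K_def by auto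
    have split: "frame_sum UNIV ?v y = frame_sum (UNIV - J) ?v y + frame_sum J ?v y" for y
      using frame_sum_Un_disjoint[of "UNIV - J" J ?v y] by auto
    show ?thesis
    proof (cases "cfinite_dim K")
      case True
      then obtain B where B: "finite B" "cspan B = K" by (auto simp: cfinite_dim_def)
      \<comment> \<open>Members outside \<open>J\<close> lie in \<open>K\<close>, spanned by
        \<open>B\<close>; the finitely many others are added to the spanning set.\<close>
      have "?v n \<in> cspan (B \<union> ?v ` J)" for n
      proof (cases "n \<in> J")
        case True
        then show ?thesis by (intro complex_vector.span_base) simp
      next
        case False
        then have "?v n \<in> cspan (?v ` (UNIV - J))" by (intro complex_vector.span_base) simp
        then have "?v n \<in> cspan B" unfolding B(2) K_def by (rule subsetD[OF closure_subset])
        then show ?thesis using complex_vector.span_mono[of B "B \<union> ?v ` J"] by blast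
      qed
      then have "?v n /\<^sub>R norm (?v n) \<in> cspan (B \<union> ?v ` J)" for n
        by (simp add: scaleR_scaleC complex_vector.span_scale)
      then show ?thesis
        using B(1) c(1) assms(3)
        by (intro unit_vectors_in_finite_span_not_Bessel[of "B \<union> ?v ` J"]) auto
    next
      case False
      \<comment> \<open>Restoring the indices in \<open>J\<close> preserves the lower bound and
        raises the upper constant by at most \<open>?S\<close>. On \<open>K\<close> the whole orbit
        then has both bounds, without any projection.\<close>
      let ?S = "\<Sum>j\<in>J. (norm (?v j))\<^sup>2"
      show ?thesis
      proof (rule core[of K L "L' + ?S"])
        show "csubspace K"
          unfolding K_def by (intro csubspace_closure complex_vector.subspace_span)
        show "\<not> cfinite_dim K" "0 < L" by fact+
      next
        fix y assume y: "y \<in> K"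
        show "ennreal (L * (norm y)\<^sup>2) \<le> frame_sum UNIV ?v y"
          unfolding split by (rule add_increasing2[OF zero_le]) (use bounds[OF y] in blast)
        have "frame_sum UNIV ?v y \<le> ennreal (L' * (norm y)\<^sup>2) + ennreal (?S * (norm y)\<^sup>2)"
          unfolding split
          by (rule add_mono[OF _ frame_sum_finite_le[OF c(1)]]) (use bounds[OF y] in blast)
        also have "\<dots> = ennreal ((L' + ?S) * (norm y)\<^sup>2)"
          using L by (subst ennreal_plus[symmetric]) (auto simp: sum_nonneg distrib_right)
        finally show "frame_sum UNIV ?v y \<le> ennreal ((L' + ?S) * (norm y)\<^sup>2)" .
      qed
    qed
  qed
qed

end
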